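(* 1. Let $\alpha\ge1$ and $M_{0,\alpha}=\sum_{x\in\mathcal{X}}p_x^{\alpha}\,I(F_x(X^n)=0)$. For $n\ge (2\alpha-1)\ln 2/(2\alpha-1-\ln 2)$ and all $\epsilon\ge0$, $$\Pr\big(M_{0,\alpha}-E[M_{0,\alpha}]\le-\epsilon\big)\le \exp\Big\{-\frac{n^{2\alpha-1}\epsilon^2}{2\gamma_\alpha}\Big\},$$ where $\gamma_\alpha=\max_{t>0}t^{2\alpha-1}e^{-t}(1-e^{-t})$. 2. Let $P$ satisfy $p_x\ge 1/k$ for all $x\in\mathcal{X}$, and let $H_0(X^n,P)=\sum_{x\in\mathcal{X}}p_x\log_2(1/p_x)\,I(F_x(X^n)=0)$. For $n\ge3$ and all $\epsilon\ge0$, $$\Pr\big(H_0-E[H_0]\le-\epsilon\big)\le \exp\Big\{-\frac{n\epsilon^2}{2\gamma(\log_2 k)^2}\Big\},$$ where $\gamma=\max_{t>0}te^{-t}(1-e^{-t})=0.2603\ldots$.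
   Context: $P$ is a discrete probability distribution on a countable alphabet $\mathcal{X}$, $p_x=P(x)$, and $X^n=(X_1,\ldots,X_n)$ are i.i.d. samples from $P$. $F_x(X^n)=\sum_{i=1}^n I(X_i=x)$ is the number of occurrences of $x$ in $X^n$, and $I(\cdot)$ is the indicator. *)

theory Defs
  imports "HOL-Probability.Probability"
begin

definition sample_pmf :: "'a pmf \<Rightarrow> nat \<Rightarrow> (nat \<Rightarrow> 'a) pmf" where
  "sample_pmf P n = Pi_pmf {..<n} undefined (\<lambda>_. P)"

definition occ :: "nat \<Rightarrow> (nat \<Rightarrow> 'a) \<Rightarrow> 'a \<Rightarrow> nat" where
  "occ n xs x = card {i. i < n \<and> xs i = x}"

definition indic_bool :: "bool \<Rightarrow> real" where
  "indic_bool b = (if b then 1 else 0)"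

definition M0 :: "'a pmf \<Rightarrow> real \<Rightarrow> nat \<Rightarrow> (nat \<Rightarrow> 'a) \<Rightarrow> real" where
  "M0 P \<alpha> n xs = (\<Sum>\<^sub>\<infinity>x. pmf P x powr \<alpha> * indic_bool (occ n xs x = 0))"

definition H0 :: "'a pmf \<Rightarrow> nat \<Rightarrow> (nat \<Rightarrow> 'a) \<Rightarrow> real" where
  "H0 P n xs = (\<Sum>\<^sub>\<infinity>x. pmf P x * log 2 (1 / pmf P x) * indic_bool (occ n xs x = 0))"

text \<open>gamma_alpha = max_{t>0} t^(2 alpha - 1) e^(-t) (1 - e^(-t)) (the maximum is attained).\<close>
definition gamma_alpha :: "real \<Rightarrow> real" where
  "gamma_alpha \<alpha> = (SUP t\<in>{0<..}. t powr (2*\<alpha> - 1) * exp (-t) * (1 - exp (-t)))"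

end

theory Submission
  imports Defs
begin

text \<open>
  Both quantities are weighted missing masses \<open>W(B) = (\<Sum>x\<notin>B. w x)\<close> of the set \<open>B\<close> of
  observed symbols, with \<open>w x = p\<^sub>x\<^sup>\<alpha>\<close> resp. \<open>w x = p\<^sub>x log\<^sub>2 (1/p\<^sub>x) \<le> p\<^sub>x log\<^sub>2 k\<close>.
  Conditioning on a symbol being missing can only enlarge the set of the other observed symbols,
  so the indicators of missing symbols are negatively associated and the moment generating
  function of \<open>-W\<close> is at most the product of the Bernoulli ones. A Bernoulli(\<open>q\<close>) variable
  has a sub-Gaussian lower tail with variance proxy \<open>q(1 - q)\<close> when \<open>q \<le> 1/2\<close> and \<open>1/4\<close> in
  general; for \<open>q = (1 - p)\<^sup>n \<le> exp (-n p)\<close> this proxy is at most \<open>\<gamma>\<^sub>\<alpha> / (n p)\<^bsup>2\<alpha>-1\<^esup>\<close>, so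
  \<open>w x \<le> C p\<^sub>x\<^sup>\<alpha>\<close> gives the total variance proxy \<open>C\<^sup>2 \<gamma>\<^sub>\<alpha> / n\<^bsup>2\<alpha>-1\<^esup>\<close> and Chernoff's bound
  concludes. Infinite alphabets are reduced to finite ones by truncating the weights.
\<close>

lemma integrable_pmf_bounded:
  fixes f :: "'b \<Rightarrow> real"
  assumes "\<And>x. \<bar>f x\<bar> \<le> C"
  shows "integrable (measure_pmf M) f"
  by (rule measure_pmf.integrable_const_bound[where B=C]) (use assms in auto)

lemma abs_expectation_pmf_le:
  fixes f :: "'b \<Rightarrow> real"
  assumes "\<And>x. \<bar>f x\<bar> \<le> C"
  shows "\<bar>measure_pmf.expectation M f\<bar> \<le> C"
proof -
  have "\<bar>measure_pmf.expectation M f\<bar> \<le> measure_pmf.expectation M (\<lambda>x. \<bar>f x\<bar>)"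
    by (rule integral_abs_bound)
  also have "\<dots> \<le> C"
    using assms by (intro measure_pmf.integral_le_const integrable_pmf_bounded[where C=C]) auto
  finally show ?thesis .
qed

lemma integral_bind_pmf_bounded:
  fixes f :: "'b \<Rightarrow> real"
  assumes "\<And>x. \<bar>f x\<bar> \<le> C"
  shows "measure_pmf.expectation (bind_pmf M N) f
           = measure_pmf.expectation M (\<lambda>x. measure_pmf.expectation (N x) f)"
  unfolding measure_pmf_bind
  by (rule integral_bind[where K="count_space UNIV" and B=C and B'=1])
     (use assms measurable_measure_pmf[of N] in
       \<open>auto simp: measure_pmf.emeasure_space_1 prob_space_imp_subprob_space
                   measure_pmf.finite_measure_axioms\<close>)

lemma expectation_pmf_split_point:
  fixes h :: "'b \<Rightarrow> real"
  assumes "\<And>z. \<bar>h z\<bar> \<le> C"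
  shows "measure_pmf.expectation M h
           = measure_pmf.expectation M (\<lambda>z. indicator (-{y}) z * h z) + pmf M y * h y"
proof -
  have "measure_pmf.expectation M h
          = measure_pmf.expectation M (\<lambda>z. indicator (-{y}) z * h z + indicator {y} z * h y)"
    by (intro Bochner_Integration.integral_cong) (auto simp: indicator_def)
  also have "\<dots> = measure_pmf.expectation M (\<lambda>z. indicator (-{y}) z * h z)
                   + measure_pmf.expectation M (\<lambda>z. indicator {y} z * h y)"
    using assms order_trans[OF abs_ge_zero assms]
    by (intro Bochner_Integration.integral_add integrable_pmf_bounded[where C=C])
       (auto simp: indicator_def)
  finally show ?thesis
    by (simp add: measure_pmf_single)
qed

lemma prob_pmf_compl_singleton: "measure_pmf.prob M (-{y}) = 1 - pmf M y"
  using measure_pmf.prob_compl[of "{y}" M] by (simp add: measure_pmf_single Compl_eq_Diff_UNIV)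

lemma expectation_pmf_mult_compl_le:
  fixes G R :: "'b \<Rightarrow> real"
  assumes G_bounded: "\<And>z. \<bar>G z\<bar> \<le> C" and R_bounded: "\<And>z. \<bar>R z\<bar> \<le> C"
    and G_min: "\<And>z. G y \<le> G z" and "R y = 0" and R_ge: "\<And>z. z \<noteq> y \<Longrightarrow> q * G z \<le> R z"
    and "0 \<le> q" "q \<le> 1"
  shows "q * (1 - pmf M y) * measure_pmf.expectation M G \<le> measure_pmf.expectation M R"
proof -
  define p where "p = pmf M y"
  define I where "I = measure_pmf.expectation M (\<lambda>z. indicator (-{y}) z * G z)"
  have "0 \<le> p" "0 \<le> C"
    using order_trans[OF abs_ge_zero G_bounded] by (simp_all add: p_def)
  have qG_bounded: "\<bar>q * G z\<bar> \<le> C" for z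
    using assms(6,7) G_bounded[of z] mult_left_le_one_le[of "\<bar>G z\<bar>" q] by (simp add: abs_mult)
  have "(1 - p) * G y = measure_pmf.expectation M (\<lambda>z. indicator (-{y}) z * G y)"
    by (simp add: p_def prob_pmf_compl_singleton)
  also have "\<dots> \<le> I"
    unfolding I_def using G_bounded G_min \<open>0 \<le> C\<close>
    by (intro integral_mono integrable_pmf_bounded[where C=C]) (auto simp: indicator_def)
  finally have "(1 - p) * (I + p * G y) \<le> I"
    using mult_left_mono[of "(1 - p) * G y" I p] \<open>0 \<le> p\<close> by (simp add: algebra_simps)
  then have "q * ((1 - p) * (I + p * G y)) \<le> q * I"
    using \<open>0 \<le> q\<close> by (rule mult_left_mono)
  also have "q * I = measure_pmf.expectation M (\<lambda>z. q * (indicator (-{y}) z * G z))"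
    by (simp add: I_def)
  also have "\<dots> \<le> measure_pmf.expectation M (\<lambda>z. indicator (-{y}) z * R z)"
    using R_bounded R_ge qG_bounded \<open>0 \<le> C\<close>
    by (intro integral_mono integrable_pmf_bounded[where C=C]) (auto simp: indicator_def)
  also have "\<dots> = measure_pmf.expectation M R"
    using expectation_pmf_split_point[OF R_bounded, where M=M and y=y] \<open>R y = 0\<close> by simp
  finally show ?thesis
    using expectation_pmf_split_point[OF G_bounded, where M=M and y=y] by (simp add: I_def p_def mult_ac)
qed

section \<open>Lower tails of Bernoulli variables\<close>

lemma mult_one_minus_mono:
  fixes x y :: real
  assumes "x \<le> y" "x + y \<le> 1"
  shows "x * (1 - x) \<le> y * (1 - y)"
proof -
  have "0 \<le> (y - x) * (1 - x - y)"
    using assms by (intro mult_nonneg_nonneg) auto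
  then show ?thesis
    by (simp add: algebra_simps)
qed

lemma tilted_bernoulli_variance_le:
  fixes p t :: real
  assumes "1/2 \<le> p" "p \<le> 1" "0 \<le> t"
  defines "u \<equiv> p * exp t / (1 + p * (exp t - 1))"
  shows "u * (1 - u) \<le> p * (1 - p)"
proof -
  define D where "D = 1 + p * (exp t - 1)"
  have "D > 0"
    unfolding D_def using assms by (intro add_pos_nonneg mult_nonneg_nonneg) auto
  have "u - p = (p * exp t - p * D) / D"
    unfolding u_def D_def[symmetric] using \<open>D > 0\<close> by (simp add: field_simps)
  also have "\<dots> = p * (1 - p) * (exp t - 1) / D"
    by (simp add: D_def algebra_simps)
  also have "\<dots> \<ge> 0"
    using assms \<open>D > 0\<close> by (intro divide_nonneg_pos mult_nonneg_nonneg) auto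
  finally have "p \<le> u" by simp
  then show ?thesis
    using mult_one_minus_mono[of "1 - u" "1 - p"] assms(1) by (simp add: mult.commute)
qed

lemma bernoulli_log_mgf_le_variance:
  fixes h p :: real
  assumes "0 \<le> h" "1/2 \<le> p" "p \<le> 1"
  shows "-h * p + ln (1 + p * (exp h - 1)) \<le> h\<^sup>2 * (p * (1 - p)) / 2"
proof (cases "h = 0")
  case False
  define L where "L = (\<lambda>h. -h * p + ln (1 + p * (exp h - 1)))"
  define L' where "L' = (\<lambda>h. -p + p * exp h / (1 + p * (exp h - 1)))"
  define L'' where "L'' = (\<lambda>h. -(p\<^sup>2) * exp h * exp h / (1 + p * (exp h - 1))\<^sup>2 +
                              p * exp h / (1 + p * (exp h - 1)))"
  define Ls where "Ls = (\<lambda>n. [L, L', L''] ! n)"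
  have D: "1 + p * (exp x - 1) > 0" if "0 \<le> x" for x
    using assms that by (intro add_pos_nonneg mult_nonneg_nonneg) auto
  have L': "(L has_real_derivative L' x) (at x)" if "x \<in> {0..h}" for x
    unfolding L_def L'_def using D[of x] that by (auto intro!: derivative_eq_intros)
  have L'': "(L' has_real_derivative L'' x) (at x)" if "x \<in> {0..h}" for x
  proof -
    have "1 + p * (exp x - 1) > 0"
      using D that by simp
    show ?thesis
      unfolding L'_def L''_def
      by (insert \<open>1 + p * (exp x - 1) > 0\<close>, (rule derivative_eq_intros refl | simp)+)
         (auto simp: divide_simps; algebra)
  qed
  have "\<forall>m t. m < 2 \<and> 0 \<le> t \<and> t \<le> h \<longrightarrow> (Ls m has_real_derivative Ls (Suc m) t) (at t)"
    using L' L'' by (auto simp: Ls_def nth_Cons split: nat.splits)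
  from Taylor[of 2 Ls L 0 h 0 h, OF _ _ this] obtain t where t: "t \<in> {0<..<h}" "L h = L'' t * h\<^sup>2 / 2"
    using assms(1) False by (auto simp: Ls_def L_def L'_def lessThan_nat_numeral)
  have "L'' t = p * exp t / (1 + p * (exp t - 1)) * (1 - p * exp t / (1 + p * (exp t - 1)))"
    by (simp add: L''_def power2_eq_square algebra_simps)
  also have "\<dots> \<le> p * (1 - p)"
    using t(1) assms by (intro tilted_bernoulli_variance_le) auto
  finally have "L'' t * h\<^sup>2 / 2 \<le> p * (1 - p) * h\<^sup>2 / 2"
    by (intro mult_right_mono divide_right_mono) auto
  then show ?thesis
    using t(2) by (simp add: L_def mult_ac)
qed simp

text \<open>Sub-Gaussian variance proxy of a Bernoulli(\<open>q\<close>) variable for deviations below its mean.\<close>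
definition bernoulli_var_proxy :: "real \<Rightarrow> real" where
  "bernoulli_var_proxy q = (if q \<le> 1/2 then q * (1 - q) else 1/4)"

lemma bernoulli_var_proxy_bounds:
  "0 \<le> q \<Longrightarrow> q \<le> 1 \<Longrightarrow> 0 \<le> bernoulli_var_proxy q \<and> bernoulli_var_proxy q \<le> 1/4"
  using mult_const_minus_self_real_le[of q 1] by (auto simp: bernoulli_var_proxy_def)

lemma bernoulli_mgf_neg_le:
  fixes q s :: real
  assumes "0 \<le> q" "q \<le> 1" "0 \<le> s"
  shows "1 - q + q * exp (- s) \<le> exp (- s * q + s\<^sup>2 * bernoulli_var_proxy q / 2)"
proof -
  define p where "p = 1 - q"
  define L where "L = -s * p + ln (1 + p * (exp s - 1))"
  have "1 + p * (exp s - 1) > 0"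
    unfolding p_def using assms by (intro add_pos_nonneg mult_nonneg_nonneg) auto
  then have "exp (L - s * q) = exp (-s) * (1 + p * (exp s - 1))"
    unfolding L_def by (simp add: exp_diff exp_add exp_minus field_simps p_def)
  also have "\<dots> = 1 - q + q * exp (- s)"
    unfolding p_def by (simp add: algebra_simps exp_minus field_simps)
  finally have "1 - q + q * exp (- s) = exp (L - s * q)" ..
  moreover have "L \<le> s\<^sup>2 * bernoulli_var_proxy q / 2"
  proof (cases "q \<le> 1/2")
    case True
    then have "L \<le> s\<^sup>2 * (p * (1 - p)) / 2"
      unfolding L_def using assms by (intro bernoulli_log_mgf_le_variance) (auto simp: p_def)
    then show ?thesis
      using True by (simp add: bernoulli_var_proxy_def p_def mult_ac)
  next
    case False
    have "L \<le> s\<^sup>2 / 8"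
      unfolding L_def using Hoeffdings_lemma_aux[of s p] assms by (simp add: p_def)
    then show ?thesis
      using False by (simp add: bernoulli_var_proxy_def)
  qed
  ultimately show ?thesis
    by simp
qed

section \<open>The constant \<open>\<gamma>\<^sub>\<alpha>\<close>\<close>

lemma powr_mult_exp_neg_le:
  fixes a t :: real
  assumes "0 \<le> a" "0 < t"
  shows "t powr a * exp (-t) \<le> (a + 1) powr a"
proof -
  have "ln (t / (a + 1)) \<le> t / (a + 1) - 1"
    using assms by (intro ln_le_minus_one) auto
  then have "a * ln t \<le> a * (t / (a + 1) - 1 + ln (a + 1))"
    using assms by (intro mult_left_mono) (auto simp: ln_div)
  also have "\<dots> \<le> t + a * ln (a + 1)"
    using assms by (simp add: field_simps)
  finally show ?thesis
    using assms by (simp add: powr_def exp_minus field_simps flip: exp_add)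
qed

lemma gamma_alpha_ge:
  fixes \<alpha> t :: real
  assumes "1/2 \<le> \<alpha>" "0 < t"
  shows "t powr (2*\<alpha> - 1) * exp (-t) * (1 - exp (-t)) \<le> gamma_alpha \<alpha>"
  unfolding gamma_alpha_def
proof (rule cSUP_upper)
  show "t \<in> {0<..}"
    using assms by simp
  have "s powr (2*\<alpha> - 1) * exp (-s) * (1 - exp (-s)) \<le> (2*\<alpha>) powr (2*\<alpha> - 1)" if "0 < s" for s
  proof -
    have "s powr (2*\<alpha> - 1) * exp (-s) * (1 - exp (-s)) \<le> s powr (2*\<alpha> - 1) * exp (-s)"
      using that by (intro mult_left_le) auto
    also have "\<dots> \<le> (2*\<alpha>) powr (2*\<alpha> - 1)"
      using powr_mult_exp_neg_le[of "2*\<alpha> - 1" s] that assms by simp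
    finally show ?thesis .
  qed
  then show "bdd_above ((\<lambda>t. t powr (2*\<alpha> - 1) * exp (-t) * (1 - exp (-t))) ` {0<..})"
    by (intro bdd_aboveI2) auto
qed

lemma gamma_alpha_ge_ln2:
  fixes \<alpha> :: real
  assumes "1/2 \<le> \<alpha>"
  shows "ln 2 powr (2*\<alpha> - 1) / 4 \<le> gamma_alpha \<alpha>"
  using gamma_alpha_ge[OF assms, of "ln 2"] by (simp add: exp_minus)

lemma gamma_alpha_pos: "1/2 \<le> \<alpha> \<Longrightarrow> 0 < gamma_alpha \<alpha>"
  by (rule less_le_trans[OF _ gamma_alpha_ge_ln2]) simp_all

lemma one_minus_power_le_exp:
  fixes p :: real
  assumes "0 \<le> p" "p \<le> 1"
  shows "(1 - p) ^ n \<le> exp (- (real n * p))"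
proof -
  have "(1 - p) ^ n \<le> exp (-p) ^ n"
    using assms
    by (intro power_mono) (auto simp: add.commute[of 1] exp_ge_add_one_self[of "-p", simplified])
  then show ?thesis
    by (simp flip: exp_of_nat_mult)
qed

lemma missing_var_proxy_le_gamma_alpha:
  fixes \<alpha> p :: real and n :: nat
  assumes "1/2 \<le> \<alpha>" "0 \<le> p" "p \<le> 1"
  shows "(real n * p) powr (2*\<alpha> - 1) * bernoulli_var_proxy ((1 - p) ^ n) \<le> gamma_alpha \<alpha>"
proof -
  define t where "t = real n * p"
  define q where "q = (1 - p) ^ n"
  define a where "a = 2*\<alpha> - 1"
  have "0 \<le> a" "0 \<le> t"
    using assms by (simp_all add: a_def t_def)
  have q: "0 \<le> q" "q \<le> 1"
    unfolding q_def using assms by (auto intro: power_le_one)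
  have q_le: "q \<le> exp (-t)"
    unfolding q_def t_def using assms(2,3) by (rule one_minus_power_le_exp)
  show ?thesis
  proof (cases "t < ln 2")
    case True
    have "t powr a * bernoulli_var_proxy q \<le> ln 2 powr a * (1/4)"
      using bernoulli_var_proxy_bounds[OF q] True \<open>0 \<le> t\<close> \<open>0 \<le> a\<close>
      by (intro mult_mono powr_mono2) auto
    also have "\<dots> \<le> gamma_alpha \<alpha>"
      using gamma_alpha_ge_ln2[OF assms(1)] by (simp add: a_def)
    finally show ?thesis
      by (simp add: t_def q_def a_def)
  next
    case False
    then have "0 < t"
      using ln_gt_zero[of 2] by linarith
    have "exp (-t) \<le> exp (- ln 2)"
      using False by simp
    then have "exp (-t) \<le> 1/2"
      by (simp add: exp_minus)
    have "bernoulli_var_proxy q = q * (1 - q)"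
      using q_le \<open>exp (-t) \<le> 1/2\<close> by (simp add: bernoulli_var_proxy_def)
    also have "\<dots> \<le> exp (-t) * (1 - exp (-t))"
      using q_le \<open>exp (-t) \<le> 1/2\<close> by (intro mult_one_minus_mono) auto
    finally have "t powr a * bernoulli_var_proxy q \<le> t powr a * (exp (-t) * (1 - exp (-t)))"
      by (intro mult_left_mono) auto
    also have "\<dots> \<le> gamma_alpha \<alpha>"
      using gamma_alpha_ge[OF assms(1) \<open>0 < t\<close>] by (simp add: a_def mult_ac)
    finally show ?thesis
      by (simp add: t_def q_def a_def)
  qed
qed

lemma weight_missing_var_proxy_le:
  fixes p w C \<alpha> :: real and n :: nat
  assumes "1/2 \<le> \<alpha>" "0 < n" "0 \<le> p" "p \<le> 1" "0 \<le> w" "w \<le> C * p powr \<alpha>"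
  shows "w\<^sup>2 * bernoulli_var_proxy ((1 - p) ^ n) \<le> p * (C\<^sup>2 * gamma_alpha \<alpha> / real n powr (2*\<alpha> - 1))"
proof -
  define N where "N = real n powr (2*\<alpha> - 1)"
  define v where "v = bernoulli_var_proxy ((1 - p) ^ n)"
  have "0 < N"
    using \<open>0 < n\<close> by (simp add: N_def)
  have "0 \<le> v"
    unfolding v_def using assms(3,4)
    by (intro bernoulli_var_proxy_bounds[THEN conjunct1]) (auto intro: power_le_one)
  have "N * (p powr (2*\<alpha> - 1) * v) \<le> gamma_alpha \<alpha>"
    using missing_var_proxy_le_gamma_alpha[of \<alpha> p n] assms(1,3,4)
    by (simp add: N_def v_def powr_mult mult_ac)
  then have pv: "p powr (2*\<alpha> - 1) * v \<le> gamma_alpha \<alpha> / N"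
    using \<open>0 < N\<close> by (simp add: field_simps)
  have "w\<^sup>2 \<le> (C * p powr \<alpha>)\<^sup>2"
    using assms(5,6) by (simp add: power_mono)
  also have "\<dots> = C\<^sup>2 * p powr (1 + (2*\<alpha> - 1))"
    by (simp add: power2_eq_square power_mult_distrib flip: powr_add)
  also have "\<dots> = C\<^sup>2 * p * p powr (2*\<alpha> - 1)"
    using \<open>0 \<le> p\<close> unfolding powr_add by simp
  finally have "w\<^sup>2 * v \<le> C\<^sup>2 * p * p powr (2*\<alpha> - 1) * v"
    using \<open>0 \<le> v\<close> by (rule mult_right_mono)
  also have "\<dots> \<le> C\<^sup>2 * p * (gamma_alpha \<alpha> / N)"
    using mult_left_mono[OF pv, of "C\<^sup>2 * p"] \<open>0 \<le> p\<close> by (simp add: mult.assoc)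
  finally show ?thesis
    by (simp add: v_def N_def mult_ac)
qed

section \<open>The missing mass of the observed set\<close>

definition observed_pmf :: "'a pmf \<Rightarrow> nat \<Rightarrow> 'a set pmf" where
  "observed_pmf P n = map_pmf (\<lambda>xs. xs ` {..<n}) (sample_pmf P n)"

lemma observed_pmf_0: "observed_pmf P 0 = return_pmf {}"
  by (simp add: observed_pmf_def sample_pmf_def map_pmf_def map_return_pmf)

lemma observed_pmf_Suc:
  "observed_pmf P (Suc n) = bind_pmf P (\<lambda>y. map_pmf (insert y) (observed_pmf P n))"
proof -
  have "sample_pmf P (Suc n) = do {y \<leftarrow> P; f \<leftarrow> sample_pmf P n; return_pmf (f(n := y))}"
    unfolding sample_pmf_def lessThan_Suc by (rule Pi_pmf_insert') auto
  moreover have "(f(n := y)) ` {..<Suc n} = insert y (f ` {..<n})" for f :: "nat \<Rightarrow> 'a" and y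
    by (auto simp: lessThan_Suc)
  ultimately show ?thesis
    unfolding observed_pmf_def by (simp add: map_pmf_def bind_assoc_pmf bind_return_pmf)
qed

lemma prob_observed_missing:
  "measure_pmf.prob (observed_pmf P n) {B. y \<notin> B} = (1 - pmf P y) ^ n"
proof -
  have "measure_pmf.prob (observed_pmf P n) {B. y \<notin> B}
          = measure_pmf.prob (sample_pmf P n) (Pi {..<n} (\<lambda>_. -{y}))"
    unfolding observed_pmf_def by (auto simp: vimage_def Pi_def intro: arg_cong[where f="measure _"])
  also have "\<dots> = (1 - pmf P y) ^ n"
    by (simp add: sample_pmf_def measure_Pi_pmf_Pi prob_pmf_compl_singleton)
  finally show ?thesis .
qed

lemma observed_missing_correlation:
  fixes g :: "'a set \<Rightarrow> real"
  assumes bounded: "\<And>A. \<bar>g A\<bar> \<le> C"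
    and mono: "\<And>A B. A \<subseteq> B \<Longrightarrow> g A \<le> g B"
    and blind: "\<And>A. g (insert y A) = g A"
  shows "(1 - pmf P y) ^ n * measure_pmf.expectation (observed_pmf P n) g
           \<le> measure_pmf.expectation (observed_pmf P n) (\<lambda>B. if y \<in> B then 0 else g B)"
  using assms
proof (induction n arbitrary: g)
  case 0
  then show ?case by (simp add: observed_pmf_0)
next
  case (Suc n)
  let ?E = "measure_pmf.expectation (observed_pmf P n)"
  define G where "G z = ?E (\<lambda>B. g (insert z B))" for z
  define R where "R z = ?E (\<lambda>B. if y \<in> insert z B then 0 else g (insert z B))" for z
  have "0 \<le> C"
    using order_trans[OF abs_ge_zero Suc.prems(1)] .
  have G_bounded: "\<bar>G z\<bar> \<le> C" and R_bounded: "\<bar>R z\<bar> \<le> C" for z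
    unfolding G_def R_def using Suc.prems(1) \<open>0 \<le> C\<close> by (auto intro!: abs_expectation_pmf_le)
  have G_min: "G y \<le> G z" for z
    unfolding G_def using Suc.prems
    by (intro integral_mono integrable_pmf_bounded[where C=C]) (auto simp: subset_insertI)
  have R_ge: "(1 - pmf P y) ^ n * G z \<le> R z" if "z \<noteq> y" for z
  proof -
    have "(1 - pmf P y) ^ n * G z \<le> ?E (\<lambda>B. if y \<in> B then 0 else g (insert z B))"
      unfolding G_def
      by (rule Suc.IH) (use Suc.prems in \<open>auto simp: insert_commute intro!: Suc.prems(2) insert_mono\<close>)
    also have "\<dots> = R z"
      unfolding R_def using that by (intro Bochner_Integration.integral_cong) auto
    finally show ?thesis .
  qed
  have "(1 - pmf P y) ^ n * (1 - pmf P y) * measure_pmf.expectation P G \<le> measure_pmf.expectation P R"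
    using G_bounded R_bounded G_min R_ge
    by (intro expectation_pmf_mult_compl_le[where C=C and y=y])
       (simp_all add: R_def pmf_le_1 power_le_one)
  moreover have "measure_pmf.expectation (observed_pmf P (Suc n)) g = measure_pmf.expectation P G"
    unfolding observed_pmf_Suc G_def by (simp add: integral_bind_pmf_bounded[OF Suc.prems(1)])
  moreover have "measure_pmf.expectation (observed_pmf P (Suc n)) (\<lambda>B. if y \<in> B then 0 else g B)
                   = measure_pmf.expectation P R"
    unfolding observed_pmf_Suc R_def
    by (subst integral_bind_pmf_bounded[where C=C]) (use Suc.prems(1) \<open>0 \<le> C\<close> in auto)
  ultimately show ?case
    by (simp add: mult_ac)
qed

lemma missing_mass_mgf_le_prod:
  fixes w :: "'a \<Rightarrow> real"
  assumes "finite S" and w: "\<And>x. 0 \<le> w x" and "0 \<le> l"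
  shows "measure_pmf.expectation (observed_pmf P n) (\<lambda>B. exp (- l * sum w (S - B)))
           \<le> (\<Prod>x\<in>S. 1 - (1 - pmf P x) ^ n + (1 - pmf P x) ^ n * exp (- l * w x))"
  using assms(1)
proof (induction S rule: finite_induct)
  case empty
  then show ?case by simp
next
  case (insert y T)
  let ?E = "measure_pmf.expectation (observed_pmf P n)"
  define f where "f B = exp (- l * sum w (T - B))" for B
  define c where "c = 1 - exp (- l * w y)"
  define q where "q = (1 - pmf P y) ^ n"
  have f: "\<bar>f B\<bar> \<le> 1" for B
    unfolding f_def using w \<open>0 \<le> l\<close> by (simp add: sum_nonneg)
  have f_mono: "f A \<le> f B" if "A \<subseteq> B" for A B
    unfolding f_def using that w \<open>0 \<le> l\<close> insert.hyps(1)
    by (auto intro!: mult_left_mono sum_mono2)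
  have f_blind: "f (insert y A) = f A" for A
    unfolding f_def using insert.hyps(2) by (simp add: Diff_insert_absorb[symmetric] Diff_insert[symmetric])
  have c: "0 \<le> c" "c \<le> 1" and q: "0 \<le> q" "q \<le> 1"
    unfolding c_def q_def using w[of y] \<open>0 \<le> l\<close> by (auto simp: pmf_le_1 power_le_one)
  have "exp (- l * sum w (insert y T - B)) = f B - c * (if y \<in> B then 0 else f B)" for B
    using insert.hyps by (simp add: f_def c_def insert_Diff_if algebra_simps exp_add[symmetric])
  moreover have "integrable (observed_pmf P n) f"
    using f by (rule integrable_pmf_bounded)
  moreover have "integrable (observed_pmf P n) (\<lambda>B. c * (if y \<in> B then 0 else f B))"
    using f c by (intro integrable_pmf_bounded[where C=1]) (auto simp: abs_mult mult_le_one)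
  ultimately have "?E (\<lambda>B. exp (- l * sum w (insert y T - B)))
                     = ?E f - c * ?E (\<lambda>B. if y \<in> B then 0 else f B)"
    by simp
  also have "\<dots> \<le> ?E f - c * (q * ?E f)"
    unfolding q_def using c(1) f f_mono f_blind
    by (intro diff_left_mono mult_left_mono observed_missing_correlation) auto
  also have "\<dots> = (1 - c * q) * ?E f"
    by (simp add: algebra_simps)
  also have "\<dots> \<le> (1 - c * q) * (\<Prod>x\<in>T. 1 - (1 - pmf P x) ^ n + (1 - pmf P x) ^ n * exp (- l * w x))"
    using insert.IH c q by (intro mult_left_mono) (auto simp: f_def[abs_def] mult_le_one)
  also have "\<dots> = (\<Prod>x\<in>insert y T. 1 - (1 - pmf P x) ^ n + (1 - pmf P x) ^ n * exp (- l * w x))"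
    using insert.hyps by (simp add: c_def q_def algebra_simps)
  finally show ?case .
qed

lemma expectation_missing_mass_finite:
  fixes w :: "'a \<Rightarrow> real"
  assumes "finite S"
  shows "measure_pmf.expectation (observed_pmf P n) (\<lambda>B. sum w (S - B))
           = (\<Sum>x\<in>S. w x * (1 - pmf P x) ^ n)"
proof -
  have "sum w (S - B) = (\<Sum>x\<in>S. w x * indicator {B. x \<notin> B} B)" for B
    using assms by (simp add: Diff_eq sum.inter_restrict indicator_def)
  moreover have "integrable (observed_pmf P n) (\<lambda>B. w x * indicator {B. x \<notin> B} B)" for x
    by (rule integrable_pmf_bounded[where C="\<bar>w x\<bar>"]) (simp add: indicator_def)
  ultimately have "measure_pmf.expectation (observed_pmf P n) (\<lambda>B. sum w (S - B))
      = (\<Sum>x\<in>S. measure_pmf.expectation (observed_pmf P n) (\<lambda>B. w x * indicator {B. x \<notin> B} B))"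
    by (simp add: Bochner_Integration.integral_sum)
  then show ?thesis
    by (simp add: prob_observed_missing)
qed

lemma missing_mass_mgf_le:
  fixes w :: "'a \<Rightarrow> real"
  assumes "finite S" and w: "\<And>x. 0 \<le> w x" and "0 \<le> l"
    and var: "(\<Sum>x\<in>S. (w x)\<^sup>2 * bernoulli_var_proxy ((1 - pmf P x) ^ n)) \<le> V"
  shows "measure_pmf.expectation (observed_pmf P n) (\<lambda>B. exp (- l * sum w (S - B)))
           \<le> exp (- l * measure_pmf.expectation (observed_pmf P n) (\<lambda>B. sum w (S - B)) + l\<^sup>2 / 2 * V)"
proof -
  define q where "q x = (1 - pmf P x) ^ n" for x
  have q: "0 \<le> q x" "q x \<le> 1" for x
    by (simp_all add: q_def pmf_le_1 power_le_one)
  have "measure_pmf.expectation (observed_pmf P n) (\<lambda>B. exp (- l * sum w (S - B)))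
          \<le> (\<Prod>x\<in>S. 1 - q x + q x * exp (- l * w x))"
    unfolding q_def using assms(1) w \<open>0 \<le> l\<close> by (rule missing_mass_mgf_le_prod)
  also have "\<dots> \<le> (\<Prod>x\<in>S. exp (- (l * w x) * q x + (l * w x)\<^sup>2 * bernoulli_var_proxy (q x) / 2))"
  proof (intro prod_mono conjI)
    fix x
    show "0 \<le> 1 - q x + q x * exp (- l * w x)"
      using q[of x] by (simp add: add_nonneg_nonneg)
    show "1 - q x + q x * exp (- l * w x)
            \<le> exp (- (l * w x) * q x + (l * w x)\<^sup>2 * bernoulli_var_proxy (q x) / 2)"
      using bernoulli_mgf_neg_le[OF q, of "l * w x"] w[of x] \<open>0 \<le> l\<close> by simp
  qed
  also have "\<dots> = exp (\<Sum>x\<in>S. - (l * w x) * q x + (l * w x)\<^sup>2 * bernoulli_var_proxy (q x) / 2)"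
    using assms(1) by (simp add: exp_sum)
  also have "\<dots> = exp (- l * (\<Sum>x\<in>S. w x * q x)
                        + l\<^sup>2 / 2 * (\<Sum>x\<in>S. (w x)\<^sup>2 * bernoulli_var_proxy (q x)))"
    by (simp add: sum.distrib sum_distrib_left sum_negf sum_subtractf power_mult_distrib mult_ac)
  also have "\<dots> \<le> exp (- l * (\<Sum>x\<in>S. w x * q x) + l\<^sup>2 / 2 * V)"
    using var by (simp add: q_def mult_left_mono)
  finally show ?thesis
    using assms(1) by (simp add: q_def expectation_missing_mass_finite)
qed

lemma finite_missing_mass_lower_tail:
  fixes w :: "'a \<Rightarrow> real"
  assumes "finite S" and w: "\<And>x. 0 \<le> w x" and "0 < V" "0 \<le> \<epsilon>"
    and var: "(\<Sum>x\<in>S. (w x)\<^sup>2 * bernoulli_var_proxy ((1 - pmf P x) ^ n)) \<le> V"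
  shows "measure_pmf.prob (observed_pmf P n)
           {B. sum w (S - B) \<le> measure_pmf.expectation (observed_pmf P n) (\<lambda>B. sum w (S - B)) - \<epsilon>}
         \<le> exp (- \<epsilon>\<^sup>2 / (2 * V))"
proof (cases "\<epsilon> = 0")
  case False
  let ?E = "measure_pmf.expectation (observed_pmf P n)"
  define E where "E = ?E (\<lambda>B. sum w (S - B))"
  define l where "l = \<epsilon> / V"
  have l: "0 < l"
    using False assms by (simp add: l_def)
  have "integrable (observed_pmf P n) (\<lambda>B. exp (- l * sum w (S - B)))"
    using w l by (intro integrable_pmf_bounded[where C=1]) (simp add: sum_nonneg)
  then have "measure_pmf.prob (observed_pmf P n) {B. sum w (S - B) \<le> E - \<epsilon>}
               \<le> exp (l * (E - \<epsilon>)) * ?E (\<lambda>B. exp (- l * sum w (S - B)))"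
    using measure_pmf.Chernoff_ineq_le[where M="observed_pmf P n" and A=UNIV and
            f="\<lambda>B. sum w (S - B)" and a="E - \<epsilon>", OF l]
    by (simp add: set_integrable_def set_lebesgue_integral_def)
  also have "\<dots> \<le> exp (l * (E - \<epsilon>)) * exp (- l * E + l\<^sup>2 / 2 * V)"
    unfolding E_def using assms(1) w l var by (intro mult_left_mono missing_mass_mgf_le) auto
  also have "\<dots> = exp (- \<epsilon>\<^sup>2 / (2 * V))"
    using \<open>0 < V\<close> by (simp add: l_def power2_eq_square field_simps flip: exp_add)
  finally show ?thesis
    by (simp add: E_def)
qed simp

lemma pmf_summable_on: "pmf P summable_on A"
  using pmf_abs_summable abs_summable_equivalent abs_summable_summable by blast

lemma infsum_le_sum_Int_plus_tail:
  fixes w :: "'a \<Rightarrow> real"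
  assumes w: "\<And>x. 0 \<le> w x" and summable: "w summable_on UNIV" and "finite S"
  shows "infsum w A \<le> sum w (S \<inter> A) + (infsum w UNIV - sum w S)"
proof -
  have sub: "w summable_on B" for B
    using summable_on_subset_banach[OF summable] by blast
  have "infsum w A = infsum w (S \<inter> A \<union> (A - S))"
    by (metis Int_Diff_Un Int_commute)
  also have "\<dots> = sum w (S \<inter> A) + infsum w (A - S)"
    using \<open>finite S\<close> by (subst infsum_Un_disjoint[OF sub sub]) auto
  also have "infsum w (A - S) \<le> infsum w (-S)"
    using w by (intro infsum_mono2 sub) auto
  also have "infsum w (-S) = infsum w UNIV - sum w S"
    using infsum_Un_disjoint[OF sub sub, of S "-S"] \<open>finite S\<close> by simp
  finally show ?thesis by simp
qed

lemma missing_mass_lower_tail_le_truncated: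
  fixes w :: "'a \<Rightarrow> real"
  assumes w: "\<And>x. 0 \<le> w x" and summable: "w summable_on UNIV" and "finite S"
  defines "tail \<equiv> infsum w UNIV - sum w S"
  shows "measure_pmf.prob (observed_pmf P n)
           {B. infsum w (-B) - measure_pmf.expectation (observed_pmf P n) (\<lambda>B. infsum w (-B)) \<le> - \<epsilon>}
         \<le> measure_pmf.prob (observed_pmf P n)
           {B. sum w (S - B) \<le> measure_pmf.expectation (observed_pmf P n) (\<lambda>B. sum w (S - B)) - (\<epsilon> - tail)}"
proof (rule measure_pmf.finite_measure_mono)
  let ?E = "measure_pmf.expectation (observed_pmf P n)"
  have sub: "w summable_on B" for B
    using summable_on_subset_banach[OF summable] by blast
  have mass_bounded: "\<bar>infsum w (-B)\<bar> \<le> infsum w UNIV" for B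
    using w infsum_nonneg[of "-B" w] infsum_mono2[OF sub sub, of "-B" UNIV] by auto
  have lower: "sum w (S - B) \<le> infsum w (-B)" for B
    using w \<open>finite S\<close> infsum_mono2[OF sub sub, of "S - B" "-B"] by auto
  have upper: "infsum w (-B) \<le> sum w (S - B) + tail" for B
    using infsum_le_sum_Int_plus_tail[OF w summable \<open>finite S\<close>, of "-B"]
    by (simp add: tail_def Diff_eq)
  have sum_integrable: "integrable (observed_pmf P n) (\<lambda>B. sum w (S - B))"
    using w \<open>finite S\<close>
    by (intro integrable_pmf_bounded[where C="sum w S"]) (auto simp: sum_nonneg sum_mono2)
  have "?E (\<lambda>B. infsum w (-B)) \<le> ?E (\<lambda>B. sum w (S - B) + tail)"
    using upper
    by (intro integral_mono integrable_pmf_bounded[OF mass_bounded]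
              Bochner_Integration.integrable_add[OF sum_integrable]) auto
  also have "\<dots> = ?E (\<lambda>B. sum w (S - B)) + tail"
    using sum_integrable by simp
  finally have expectation_le: "?E (\<lambda>B. infsum w (-B)) \<le> ?E (\<lambda>B. sum w (S - B)) + tail" .
  show "{B. infsum w (-B) - ?E (\<lambda>B. infsum w (-B)) \<le> - \<epsilon>}
          \<subseteq> {B. sum w (S - B) \<le> ?E (\<lambda>B. sum w (S - B)) - (\<epsilon> - tail)}"
  proof (intro Collect_mono impI)
    fix B
    assume "infsum w (-B) - ?E (\<lambda>B. infsum w (-B)) \<le> - \<epsilon>"
    with lower[of B] expectation_le show "sum w (S - B) \<le> ?E (\<lambda>B. sum w (S - B)) - (\<epsilon> - tail)"
      by linarith
  qed
qed simp

lemma missing_mass_lower_tail: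
  fixes w :: "'a \<Rightarrow> real"
  assumes w: "\<And>x. 0 \<le> w x" and summable: "w summable_on UNIV" and "0 < V" "0 \<le> \<epsilon>"
    and var: "\<And>x. (w x)\<^sup>2 * bernoulli_var_proxy ((1 - pmf P x) ^ n) \<le> pmf P x * V"
  shows "measure_pmf.prob (observed_pmf P n)
           {B. infsum w (-B) - measure_pmf.expectation (observed_pmf P n) (\<lambda>B. infsum w (-B)) \<le> - \<epsilon>}
         \<le> exp (- \<epsilon>\<^sup>2 / (2 * V))"
    (is "?Pr \<le> _")
proof (cases "\<epsilon> = 0")
  case False
  have approx: "?Pr \<le> exp (- (\<epsilon> - \<delta>)\<^sup>2 / (2 * V))" if "0 < \<delta>" "\<delta> < \<epsilon>" for \<delta>
  proof -
    obtain S where S: "finite S" "dist (sum w S) (infsum w UNIV) \<le> \<delta>"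
      using infsum_finite_approximation[OF summable \<open>0 < \<delta>\<close>] by blast
    define tail where "tail = infsum w UNIV - sum w S"
    have "tail \<le> \<delta>"
      using S(2) by (simp add: dist_real_def tail_def)
    then have "0 \<le> \<epsilon> - tail" "(\<epsilon> - \<delta>)\<^sup>2 \<le> (\<epsilon> - tail)\<^sup>2"
      using that by (auto intro: power_mono)
    have "(\<Sum>x\<in>S. (w x)\<^sup>2 * bernoulli_var_proxy ((1 - pmf P x) ^ n)) \<le> (\<Sum>x\<in>S. pmf P x * V)"
      by (rule sum_mono) (rule var)
    also have "\<dots> = measure_pmf.prob P S * V"
      using S(1) by (simp add: sum_distrib_right measure_measure_pmf_finite)
    also have "\<dots> \<le> V"
      using \<open>0 < V\<close> by (simp add: mult_left_le_one_le)
    finally have var_S: "(\<Sum>x\<in>S. (w x)\<^sup>2 * bernoulli_var_proxy ((1 - pmf P x) ^ n)) \<le> V" .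
    have "?Pr \<le> exp (- (\<epsilon> - tail)\<^sup>2 / (2 * V))"
      using order_trans[OF missing_mass_lower_tail_le_truncated[OF w summable S(1)]
                          finite_missing_mass_lower_tail[OF S(1) w \<open>0 < V\<close> \<open>0 \<le> \<epsilon> - tail\<close> var_S,
                            unfolded tail_def]]
      by (simp add: tail_def)
    also have "\<dots> \<le> exp (- (\<epsilon> - \<delta>)\<^sup>2 / (2 * V))"
      using \<open>(\<epsilon> - \<delta>)\<^sup>2 \<le> (\<epsilon> - tail)\<^sup>2\<close> \<open>0 < V\<close> by (simp add: divide_right_mono)
    finally show ?thesis .
  qed
  have "((\<lambda>\<delta>. exp (- (\<epsilon> - \<delta>)\<^sup>2 / (2 * V))) \<longlongrightarrow> exp (- (\<epsilon> - 0)\<^sup>2 / (2 * V))) (at_right 0)"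
    using \<open>0 < V\<close> by (intro tendsto_intros) auto
  moreover have "\<forall>\<^sub>F \<delta> in at_right 0. ?Pr \<le> exp (- (\<epsilon> - \<delta>)\<^sup>2 / (2 * V))"
    using eventually_at_right_real[of 0 \<epsilon>] False \<open>0 \<le> \<epsilon>\<close> approx
    by (auto elim!: eventually_mono)
  ultimately show ?thesis
    by (simp add: tendsto_lowerbound)
qed simp

lemma sample_missing_mass_eq:
  "(\<Sum>\<^sub>\<infinity>x. w x * indic_bool (occ n xs x = 0)) = infsum w (- xs ` {..<n})"
  by (rule infsum_cong_neutral) (auto simp: indic_bool_def occ_def)

lemma weighted_missing_mass_lower_tail:
  fixes w :: "'a \<Rightarrow> real"
  assumes "1 \<le> \<alpha>" "0 < C" "0 < n" "0 \<le> \<epsilon>"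
    and w: "\<And>x. 0 \<le> w x" "\<And>x. w x \<le> C * pmf P x powr \<alpha>"
  defines "F \<equiv> \<lambda>xs. \<Sum>\<^sub>\<infinity>x. w x * indic_bool (occ n xs x = 0)"
  shows "measure_pmf.prob (sample_pmf P n)
           {xs. F xs - measure_pmf.expectation (sample_pmf P n) F \<le> - \<epsilon>}
         \<le> exp (- (real n powr (2*\<alpha> - 1) * \<epsilon>\<^sup>2) / (2 * C\<^sup>2 * gamma_alpha \<alpha>))"
proof -
  define N where "N = real n powr (2*\<alpha> - 1)"
  define V where "V = C\<^sup>2 * gamma_alpha \<alpha> / N"
  have "0 < N"
    using \<open>0 < n\<close> by (simp add: N_def)
  have "0 < V"
    using \<open>0 < N\<close> \<open>0 < C\<close> gamma_alpha_pos[of \<alpha>] \<open>1 \<le> \<alpha>\<close> by (simp add: V_def)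
  have w_le_pmf: "w x \<le> C * pmf P x" for x
    using w(2)[of x] \<open>0 < C\<close> powr_le_one_le[of "pmf P x" \<alpha>] \<open>1 \<le> \<alpha>\<close>
    by (cases "pmf P x = 0") (auto simp: pmf_le_1 intro: order_trans)
  have summable: "w summable_on UNIV"
    using w(1) w_le_pmf
    by (intro summable_on_comparison_test[OF summable_on_cmult_right[OF pmf_summable_on]]) auto
  have var: "(w x)\<^sup>2 * bernoulli_var_proxy ((1 - pmf P x) ^ n) \<le> pmf P x * V" for x
    unfolding V_def N_def using assms(1,3) w
    by (intro weight_missing_var_proxy_le) (simp_all add: pmf_le_1)
  have "F = (\<lambda>xs. infsum w (- xs ` {..<n}))"
    by (simp add: F_def sample_missing_mass_eq)
  then have "measure_pmf.prob (sample_pmf P n) {xs. F xs - measure_pmf.expectation (sample_pmf P n) F \<le> - \<epsilon>}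
      = measure_pmf.prob (observed_pmf P n)
          {B. infsum w (-B) - measure_pmf.expectation (observed_pmf P n) (\<lambda>B. infsum w (-B)) \<le> - \<epsilon>}"
    by (simp add: observed_pmf_def vimage_def)
  also have "\<dots> \<le> exp (- \<epsilon>\<^sup>2 / (2 * V))"
    using w(1) summable \<open>0 < V\<close> \<open>0 \<le> \<epsilon>\<close> var by (rule missing_mass_lower_tail)
  also have "\<dots> = exp (- (N * \<epsilon>\<^sup>2) / (2 * C\<^sup>2 * gamma_alpha \<alpha>))"
    using \<open>0 < N\<close> by (simp add: V_def field_simps)
  finally show ?thesis
    by (simp add: N_def)
qed

lemma M0_lower_tail:
  assumes "1 \<le> \<alpha>" "0 < n" "0 \<le> \<epsilon>"
  shows "measure_pmf.prob (sample_pmf P n)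
           {xs. M0 P \<alpha> n xs - measure_pmf.expectation (sample_pmf P n) (M0 P \<alpha> n) \<le> - \<epsilon>}
         \<le> exp (- (real n powr (2*\<alpha> - 1) * \<epsilon>\<^sup>2) / (2 * gamma_alpha \<alpha>))"
  using weighted_missing_mass_lower_tail[where w="\<lambda>x. pmf P x powr \<alpha>" and C=1] assms
  unfolding M0_def[abs_def] by simp

lemma H0_lower_tail:
  assumes "0 < k" and pmf_ge: "\<And>x. x \<in> set_pmf P \<Longrightarrow> 1 / k \<le> pmf P x"
    and "0 < n" "0 \<le> \<epsilon>"
  shows "measure_pmf.prob (sample_pmf P n)
           {xs. H0 P n xs - measure_pmf.expectation (sample_pmf P n) (H0 P n) \<le> - \<epsilon>}
         \<le> exp (- (real n * \<epsilon>\<^sup>2) / (2 * gamma_alpha 1 * (log 2 k)\<^sup>2))"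
proof (cases "k = 1")
  \<comment> \<open>For \<open>k = 1\<close> the bound is \<open>exp 0 = 1\<close>, since \<open>x / 0 = 0\<close>.\<close>
  case False
  obtain x0 where "x0 \<in> set_pmf P"
    using set_pmf_not_empty[of P] by blast
  then have "1 \<le> k * pmf P x0"
    using pmf_ge[of x0] \<open>0 < k\<close> by (simp add: field_simps)
  also have "\<dots> \<le> k"
    using \<open>0 < k\<close> by (simp add: mult_left_le pmf_le_1)
  finally have "1 < k"
    using False by simp
  have "0 \<le> pmf P x * log 2 (1 / pmf P x) \<and> pmf P x * log 2 (1 / pmf P x) \<le> log 2 k * pmf P x" for x
  proof (cases "x \<in> set_pmf P")
    case True
    then have "0 < pmf P x" "1 / pmf P x \<le> k"
      using pmf_ge[OF True] \<open>0 < k\<close> by (auto simp: set_pmf_iff field_simps)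
    then show ?thesis
      using pmf_le_1[of P x] \<open>0 < k\<close> by (auto simp: mult.commute log_le_cancel_iff intro!: mult_right_mono)
  qed (simp add: set_pmf_iff)
  then show ?thesis
    using weighted_missing_mass_lower_tail[where w="\<lambda>x. pmf P x * log 2 (1 / pmf P x)"
            and \<alpha>=1 and C="log 2 k"] \<open>1 < k\<close> assms(3,4)
    unfolding H0_def[abs_def] by (simp add: mult_ac)
qed simp

theorem corollary1:
  fixes P :: "'a pmf"
  shows "(\<forall>(\<alpha>::real) (n::nat) (\<epsilon>::real).
            \<alpha> \<ge> 1 \<and> real n \<ge> (2*\<alpha> - 1) * ln 2 / (2*\<alpha> - 1 - ln 2) \<and> \<epsilon> \<ge> 0 \<longrightarrow>
            measure_pmf.prob (sample_pmf P n)
              {xs. M0 P \<alpha> n xs - measure_pmf.expectation (sample_pmf P n) (M0 P \<alpha> n) \<le> - \<epsilon>}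
            \<le> exp (- (real n powr (2*\<alpha> - 1) * \<epsilon>\<^sup>2) / (2 * gamma_alpha \<alpha>)))
       \<and> (\<forall>(k::real) (n::nat) (\<epsilon>::real).
            k > 0 \<and> (\<forall>x\<in>set_pmf P. pmf P x \<ge> 1 / k) \<and> n \<ge> 3 \<and> \<epsilon> \<ge> 0 \<longrightarrow>
            measure_pmf.prob (sample_pmf P n)
              {xs. H0 P n xs - measure_pmf.expectation (sample_pmf P n) (H0 P n) \<le> -\<epsilon>}
            \<le> exp (- (real n * \<epsilon>\<^sup>2) / (2 * gamma_alpha 1 * (log 2 k)\<^sup>2)))"
proof (intro conjI allI impI)
  fix \<alpha> \<epsilon> :: real and n :: nat
  assume asm: "\<alpha> \<ge> 1 \<and> real n \<ge> (2*\<alpha> - 1) * ln 2 / (2*\<alpha> - 1 - ln 2) \<and> \<epsilon> \<ge> 0"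
  \<comment> \<open>The lower bound on \<open>n\<close> is only needed to ensure \<open>n > 0\<close>.\<close>
  have "0 < (2*\<alpha> - 1) * ln 2 / (2*\<alpha> - 1 - ln 2)"
    using asm ln_2_less_1 by (intro divide_pos_pos mult_pos_pos) auto
  then have "0 < n"
    using asm by linarith
  with asm show "measure_pmf.prob (sample_pmf P n)
              {xs. M0 P \<alpha> n xs - measure_pmf.expectation (sample_pmf P n) (M0 P \<alpha> n) \<le> - \<epsilon>}
            \<le> exp (- (real n powr (2*\<alpha> - 1) * \<epsilon>\<^sup>2) / (2 * gamma_alpha \<alpha>))"
    by (intro M0_lower_tail) auto
next
  fix k \<epsilon> :: real and n :: nat
  assume "k > 0 \<and> (\<forall>x\<in>set_pmf P. pmf P x \<ge> 1 / k) \<and> n \<ge> 3 \<and> \<epsilon> \<ge> 0"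
  then show "measure_pmf.prob (sample_pmf P n)
              {xs. H0 P n xs - measure_pmf.expectation (sample_pmf P n) (H0 P n) \<le> -\<epsilon>}
            \<le> exp (- (real n * \<epsilon>\<^sup>2) / (2 * gamma_alpha 1 * (log 2 k)\<^sup>2))"
    by (intro H0_lower_tail) auto
qed

end
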